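(* Let $\theta\colon\mathbb{Z}\to\mathbb{Z}$, $z\mapsto 0$, be the annihilating homomorphism of the additive group of integers, and let $\tau$ be a Hausdorff locally compact shift-continuous topology on $\mathbf{B}(\mathbb{Z},\theta)$. Then exactly one of the following conditions holds: (i) $\tau$ is discrete; (ii) $\tau=\tau_{\mathbf{cf}}$; (iii) $\tau=\tau_{+}$; (iv) $\tau=\tau_{-}$.
   Context: $\mathbb{N}$ is the set of positive integers and $\mathbb{N}_0$ the set of non-negative integers. A topology on a semigroup is shift-continuous if multiplication is separately continuous. The Reilly semigroup $\mathbf{B}(\mathbb{Z},\theta)$ is the set $\mathbb{N}_0\times\mathbb{Z}\times\mathbb{N}_0$ with $$(i,s,j)\cdot(m,t,n)=\left(i+m-\min\{j,m\},\ \theta^{m-\min\{j,m\}}(s)+\theta^{j-\min\{j,m\}}(t),\ j+n-\min\{j,m\}\right),$$ where $\theta^0$ is the identity map and $\theta^k$ is the $k$-fold iterate. For $A\subseteq\mathbb{Z}$ and $i,j\in\mathbb{N}_0$ put $A_{i,j}=\{(i,s,j)\colon s\in A\}$ and $A_{i,j}^0=A_{i,j}\cup\{(i+1,0,j+1)\}$. The topologies $\tau_{\mathbf{cf}},\tau_+,\tau_-$ on $\mathbf{B}(\mathbb{Z},\theta)$: in each of them a point $(i,g,j)$ is isolated if $g\neq 0$, or $i=0$, or $j=0$; and for $i,j\in\mathbb{N}$ a base at the point $(i,0,j)$ is given by - for $\tau_{\mathbf{cf}}$: all sets $(\mathbb{Z}\setminus F)_{i-1,j-1}^0$, $F$ a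 finite subset of $\mathbb{Z}$; - for $\tau_{+}$: all sets $(\mathbb{N}\setminus F)_{i-1,j-1}^0$, $F$ a finite subset of $\mathbb{N}$; - for $\tau_{-}$: all sets $\left((-\mathbb{N})\setminus(-F)\right)_{i-1,j-1}^0$, $F$ a finite subset of $\mathbb{N}$, where $-A=\{-m\colon m\in A\}$. *)

theory Defs
  imports "HOL-Analysis.Analysis"
begin

section \<open>The Reilly semigroup over the integers\<close>

type_synonym reilly = "nat \<times> int \<times> nat"

text \<open>The natural number subtractions never truncate, since the minimum of \<open>j\<close> and \<open>m\<close>
  is at most \<open>j\<close> and at most \<open>m\<close>.\<close>

definition reilly_mult :: "(int \<Rightarrow> int) \<Rightarrow> reilly \<Rightarrow> reilly \<Rightarrow> reilly" where
  "reilly_mult \<theta> = (\<lambda>(i, s, j) (m, t, n).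
     (i + m - min j m,
      (\<theta> ^^ (m - min j m)) s + (\<theta> ^^ (j - min j m)) t,
      j + n - min j m))"

definition shift_continuous :: "('a \<Rightarrow> 'a \<Rightarrow> 'a) \<Rightarrow> 'a topology \<Rightarrow> bool" where
  "shift_continuous f X \<longleftrightarrow>
     (\<forall>a \<in> topspace X. continuous_map X X (\<lambda>x. f a x) \<and> continuous_map X X (\<lambda>x. f x a))"

lemma reilly_mult_assoc:
  assumes "\<And>x y. \<theta> (x + y) = \<theta> x + \<theta> y"
  shows "reilly_mult \<theta> (reilly_mult \<theta> a b) c = reilly_mult \<theta> a (reilly_mult \<theta> b c)"
proof -
  have add: "(\<theta> ^^ k) (x + y) = (\<theta> ^^ k) x + (\<theta> ^^ k) y" for k x y
    by (induction k) (simp_all add: assms)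
  have comp: "(\<theta> ^^ k) ((\<theta> ^^ l) x) = (\<theta> ^^ (k + l)) x" for k l x
    by (simp add: funpow_add)
  obtain i s j where a: "a = (i, s, j)" by (cases a)
  obtain m t n where b: "b = (m, t, n)" by (cases b)
  obtain p u q where c: "c = (p, u, q)" by (cases c)
  consider "j \<le> m" "n \<le> p" | "j \<le> m" "p \<le> n" | "m \<le> j" "n + (j - m) \<le> p"
    | "m \<le> j" "n \<le> p" "p \<le> n + (j - m)" | "m \<le> j" "p \<le> n" by linarith
  then show ?thesis
  proof cases
    case 1
    then obtain d e where "m = j + d" "p = n + e" by (meson le_Suc_ex)
    then show ?thesis unfolding a b c reilly_mult_def by (simp add: add comp min_def add.commute)
  next
    case 2
    then obtain d e where "m = j + d" "n = p + e" by (meson le_Suc_ex)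
    then show ?thesis unfolding a b c reilly_mult_def by (simp add: add comp min_def)
  next
    case 3
    then obtain d e where "j = m + d" "p = n + d + e" by (metis le_Suc_ex add_diff_cancel_left')
    then show ?thesis unfolding a b c reilly_mult_def by (simp add: add comp min_def add.commute)
  next
    case 4
    then obtain e d' where "p = n + e" "j = m + (e + d')"
      by (metis (no_types, lifting) add_le_cancel_left le_Suc_ex add_diff_cancel_left')
    then show ?thesis unfolding a b c reilly_mult_def by (simp add: add comp min_def)
  next
    case 5
    then obtain d e where "j = m + d" "n = p + e" by (meson le_Suc_ex)
    then show ?thesis unfolding a b c reilly_mult_def by (simp add: add comp min_def add.commute)
  qed
qed


section \<open>The topologies\<close>

definition layer :: "int set \<Rightarrow> nat \<Rightarrow> nat \<Rightarrow> reilly set" where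
  "layer A i j = {(i, s, j) |s. s \<in> A}"

definition layer0 :: "int set \<Rightarrow> nat \<Rightarrow> nat \<Rightarrow> reilly set" where
  "layer0 A i j = layer A i j \<union> {(i + 1, 0, j + 1)}"

text \<open>
  The base at a point is read as a base of (not necessarily open) neighbourhoods. This matters
  for the cofinite topology below: if \<open>0 \<notin> F\<close> and \<open>i, j \<ge> 2\<close>, then the set
  \<open>layer0 (UNIV - F) (i - 1) (j - 1)\<close> contains the non-isolated point \<open>(i - 1, 0, j - 1)\<close>
  without being a neighbourhood of it.\<close>

definition nbhd_topology :: "('a \<Rightarrow> 'a set set) \<Rightarrow> 'a topology" where
  "nbhd_topology \<B> = topology (\<lambda>U. \<forall>x\<in>U. \<exists>V\<in>\<B> x. V \<subseteq> U)"

definition reilly_base :: "int set set \<Rightarrow> reilly \<Rightarrow> reilly set set" where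
  "reilly_base \<A> = (\<lambda>(i, g, j).
     if g \<noteq> 0 \<or> i = 0 \<or> j = 0 then {{(i, g, j)}}
     else {layer0 A (i - 1) (j - 1) |A. A \<in> \<A>})"

definition cf_family :: "int set set" where
  "cf_family = {UNIV - F |F. finite F}"

definition plus_family :: "int set set" where
  "plus_family = {{0<..} - F |F. finite F \<and> F \<subseteq> {0<..}}"

definition minus_family :: "int set set" where
  "minus_family = {uminus ` {0<..} - uminus ` F |F. finite F \<and> F \<subseteq> {0<..}}"

definition tau_cf :: "reilly topology" where
  "tau_cf = nbhd_topology (reilly_base cf_family)"

definition tau_plus :: "reilly topology" where
  "tau_plus = nbhd_topology (reilly_base plus_family)"

definition tau_minus :: "reilly topology" where
  "tau_minus = nbhd_topology (reilly_base minus_family)"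


subsection \<open>The families are neighbourhood bases of the topologies they define\<close>

lemma openin_nbhd_topology:
  assumes ne: "\<And>x. \<B> x \<noteq> {}"
    and dir: "\<And>x V W. V \<in> \<B> x \<Longrightarrow> W \<in> \<B> x \<Longrightarrow> \<exists>Z\<in>\<B> x. Z \<subseteq> V \<inter> W"
  shows "openin (nbhd_topology \<B>) U \<longleftrightarrow> (\<forall>x\<in>U. \<exists>V\<in>\<B> x. V \<subseteq> U)"
proof -
  have "istopology (\<lambda>U. \<forall>x\<in>U. \<exists>V\<in>\<B> x. V \<subseteq> U)"
    unfolding istopology_def
  proof (intro conjI allI impI ballI)
    fix S T x
    assume S: "\<forall>x\<in>S. \<exists>V\<in>\<B> x. V \<subseteq> S" and T: "\<forall>x\<in>T. \<exists>V\<in>\<B> x. V \<subseteq> T" and x: "x \<in> S \<inter> T"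
    obtain V where V: "V \<in> \<B> x" "V \<subseteq> S" using S x by blast
    obtain W where W: "W \<in> \<B> x" "W \<subseteq> T" using T x by blast
    obtain Z where "Z \<in> \<B> x" "Z \<subseteq> V \<inter> W" using dir[OF V(1) W(1)] by blast
    then show "\<exists>V\<in>\<B> x. V \<subseteq> S \<inter> T" using V W by blast
  next
    fix \<K> x
    assume K: "\<forall>K\<in>\<K>. \<forall>x\<in>K. \<exists>V\<in>\<B> x. V \<subseteq> K" and "x \<in> \<Union>\<K>"
    then obtain K where "K \<in> \<K>" "x \<in> K" by blast
    with K obtain V where "V \<in> \<B> x" "V \<subseteq> K" by blast
    then show "\<exists>V\<in>\<B> x. V \<subseteq> \<Union>\<K>" using \<open>K \<in> \<K>\<close> by blast
  qed
  then show ?thesis unfolding nbhd_topology_def by simp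
qed

definition filtered_family :: "int set set \<Rightarrow> bool" where
  "filtered_family \<A> \<longleftrightarrow> \<A> \<noteq> {} \<and> (\<forall>A\<in>\<A>. \<forall>B\<in>\<A>. A \<inter> B \<in> \<A>) \<and> (\<forall>A\<in>\<A>. \<exists>B\<in>\<A>. B \<subseteq> A - {0})"

lemma filtered_cf_family: "filtered_family cf_family"
  unfolding filtered_family_def
proof (intro conjI ballI)
  show "cf_family \<noteq> {}" unfolding cf_family_def by blast
next
  fix A B assume "A \<in> cf_family" "B \<in> cf_family"
  then obtain F G where "finite F" "A = UNIV - F" "finite G" "B = UNIV - G"
    unfolding cf_family_def by blast
  then have "A \<inter> B = UNIV - (F \<union> G)" "finite (F \<union> G)" by auto
  then show "A \<inter> B \<in> cf_family" unfolding cf_family_def by blast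
next
  fix A assume "A \<in> cf_family"
  then obtain F where "finite F" "A = UNIV - F" unfolding cf_family_def by blast
  then have "A - {0} = UNIV - insert 0 F" "finite (insert 0 F)" by auto
  then have "A - {0} \<in> cf_family" unfolding cf_family_def by blast
  then show "\<exists>B\<in>cf_family. B \<subseteq> A - {0}" by blast
qed

lemma filtered_plus_family: "filtered_family plus_family"
  unfolding filtered_family_def
proof (intro conjI ballI)
  show "plus_family \<noteq> {}" unfolding plus_family_def by blast
next
  fix A B assume "A \<in> plus_family" "B \<in> plus_family"
  then obtain F G where "finite F" "F \<subseteq> {0<..}" "A = {0<..} - F"
    and "finite G" "G \<subseteq> {0<..}" "B = {0<..} - G"
    unfolding plus_family_def by blast
  then have "A \<inter> B = {0<..} - (F \<union> G)" "finite (F \<union> G)" "F \<union> G \<subseteq> {0<..}" by auto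
  then show "A \<inter> B \<in> plus_family" unfolding plus_family_def by blast
next
  fix A assume A: "A \<in> plus_family"
  then have "0 \<notin> A" unfolding plus_family_def by auto
  then show "\<exists>B\<in>plus_family. B \<subseteq> A - {0}" using A by blast
qed

lemma filtered_minus_family: "filtered_family minus_family"
  unfolding filtered_family_def
proof (intro conjI ballI)
  show "minus_family \<noteq> {}" unfolding minus_family_def by blast
next
  fix A B assume "A \<in> minus_family" "B \<in> minus_family"
  then obtain F G where "finite F" "F \<subseteq> {0<..}" "A = uminus ` {0<..} - uminus ` F"
    and "finite G" "G \<subseteq> {0<..}" "B = uminus ` {0<..} - uminus ` G"
    unfolding minus_family_def by blast
  then have "A \<inter> B = uminus ` {0<..} - uminus ` (F \<union> G)" "finite (F \<union> G)" "F \<union> G \<subseteq> {0<..}"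
    unfolding image_Un by auto
  then show "A \<inter> B \<in> minus_family" unfolding minus_family_def by blast
next
  fix A assume A: "A \<in> minus_family"
  then have "0 \<notin> A" unfolding minus_family_def by auto
  then show "\<exists>B\<in>minus_family. B \<subseteq> A - {0}" using A by blast
qed

lemma layer0_mono: "A \<subseteq> B \<Longrightarrow> layer0 A i j \<subseteq> layer0 B i j"
  by (auto simp: layer0_def layer_def)

lemma openin_reilly_base:
  assumes "filtered_family \<A>"
  shows "openin (nbhd_topology (reilly_base \<A>)) U \<longleftrightarrow> (\<forall>x\<in>U. \<exists>V\<in>reilly_base \<A> x. V \<subseteq> U)"
proof (rule openin_nbhd_topology)
  show "reilly_base \<A> x \<noteq> {}" for x
    using assms by (cases x) (auto simp: reilly_base_def filtered_family_def)
next
  fix x V W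
  assume VW: "V \<in> reilly_base \<A> x" "W \<in> reilly_base \<A> x"
  obtain i g j where x: "x = (i, g, j)" by (cases x)
  show "\<exists>Z\<in>reilly_base \<A> x. Z \<subseteq> V \<inter> W"
  proof (cases "g \<noteq> 0 \<or> i = 0 \<or> j = 0")
    case True
    then show ?thesis using VW by (auto simp: reilly_base_def x)
  next
    case False
    then obtain A B where A: "A \<in> \<A>" "V = layer0 A (i - 1) (j - 1)"
      and B: "B \<in> \<A>" "W = layer0 B (i - 1) (j - 1)"
      using VW by (auto simp: reilly_base_def x)
    have "A \<inter> B \<in> \<A>" using A B assms by (auto simp: filtered_family_def)
    then have "layer0 (A \<inter> B) (i - 1) (j - 1) \<in> reilly_base \<A> x"
      using False by (auto simp: reilly_base_def x)
    moreover have "layer0 (A \<inter> B) (i - 1) (j - 1) \<subseteq> V \<inter> W"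
      using A B layer0_mono by blast
    ultimately show ?thesis by blast
  qed
qed

lemma topspace_reilly_base:
  assumes "filtered_family \<A>"
  shows "topspace (nbhd_topology (reilly_base \<A>)) = UNIV"
proof -
  have "reilly_base \<A> x \<noteq> {}" for x
    using assms by (cases x) (auto simp: reilly_base_def filtered_family_def)
  then have "openin (nbhd_topology (reilly_base \<A>)) UNIV"
    unfolding openin_reilly_base[OF assms] by (meson ex_in_conv subset_UNIV)
  then show ?thesis using openin_subset by blast
qed

lemma nbhd_base_reilly_base:
  assumes "filtered_family \<A>"
  shows "(\<exists>U. openin (nbhd_topology (reilly_base \<A>)) U \<and> x \<in> U \<and> U \<subseteq> N)
         \<longleftrightarrow> (\<exists>V\<in>reilly_base \<A> x. V \<subseteq> N)"
proof
  assume "\<exists>U. openin (nbhd_topology (reilly_base \<A>)) U \<and> x \<in> U \<and> U \<subseteq> N"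
  then show "\<exists>V\<in>reilly_base \<A> x. V \<subseteq> N"
    unfolding openin_reilly_base[OF assms] by (meson subset_trans)
next
  assume "\<exists>V\<in>reilly_base \<A> x. V \<subseteq> N"
  then obtain V where V: "V \<in> reilly_base \<A> x" "V \<subseteq> N" by blast
  obtain i g j where x: "x = (i, g, j)" by (cases x)
  show "\<exists>U. openin (nbhd_topology (reilly_base \<A>)) U \<and> x \<in> U \<and> U \<subseteq> N"
  proof (cases "g \<noteq> 0 \<or> i = 0 \<or> j = 0")
    case True
    then have "openin (nbhd_topology (reilly_base \<A>)) {x}"
      unfolding openin_reilly_base[OF assms] by (auto simp: reilly_base_def x)
    moreover have "V = {x}" using V True by (auto simp: reilly_base_def x)
    ultimately show ?thesis using V by blast
  next
    case False
    then obtain A where A: "A \<in> \<A>" "V = layer0 A (i - 1) (j - 1)"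
      using V by (auto simp: reilly_base_def x)
    obtain B where B: "B \<in> \<A>" "B \<subseteq> A - {0}"
      using A(1) assms unfolding filtered_family_def by blast
    let ?U = "layer0 B (i - 1) (j - 1)"
    have "\<exists>W\<in>reilly_base \<A> y. W \<subseteq> ?U" if y: "y \<in> ?U" for y
    proof (cases "y = x")
      case True
      then show ?thesis using False B(1) by (auto simp: reilly_base_def x)
    next
      case yx: False
      then obtain s where s: "y = (i - 1, s, j - 1)" "s \<in> B"
        using y False by (auto simp: layer0_def layer_def x)
      then have "s \<noteq> 0" using B(2) by auto
      then show ?thesis using s y by (auto simp: reilly_base_def)
    qed
    then have "openin (nbhd_topology (reilly_base \<A>)) ?U"
      unfolding openin_reilly_base[OF assms] by blast
    moreover have "x \<in> ?U" using False by (auto simp: layer0_def x)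
    moreover have "?U \<subseteq> N" using layer0_mono[of B A] A(2) B(2) V(2) by blast
    ultimately show ?thesis by blast
  qed
qed

end

theory Submission
  imports Defs
begin

text \<open>
  With the annihilating homomorphism the product \<open>(i, s, j) \<cdot> (m, t, n)\<close> adds the integer entries
  if \<open>j = m\<close> and otherwise keeps only the entry belonging to the larger of \<open>j\<close> and \<open>m\<close>. So a shift
  can move a layer, translate it, or collapse it to a single point. A Hausdorff shift-continuous topology
  feels this strongly: each idempotent \<open>(k, 0, k)\<close> makes the set of its fixed points closed, hence each
  set of triples with bounded outer entries is open, and within such a set the collapsing shifts take only
  finitely many unwanted values, which can be removed. The outcome is that a punctured layer is open,
  and that \<open>(i + 1, 0, j + 1)\<close> has a neighbourhood made of its own layer and of the punctured layer at
  \<open>(i, j)\<close> (\<open>open_two_layers\<close>).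

  Each layer is a copy of the integers on which translations act by continuous maps. As it is countable, local
  compactness and the Baire category theorem give an isolated point, and translating it shows that a layer
  is discrete as a subspace (\<open>relatively_open_singleton\<close>). So the only points that can fail to be isolated
  are the \<open>(i + 1, 0, j + 1)\<close>, and the only points that can accumulate there are those of the layer
  at \<open>(i, j)\<close>. The whole topology is therefore encoded by the filters of integer sets that the neighbourhoods
  of these points cut out (\<open>openin_iff_large\<close>).

  Shifts carry the points \<open>(i + 1, 0, j + 1)\<close> into each other together with the layers below them,
  so all these filters are one and the same; shifts that fix the point translate the layer, so the filter
  is invariant under translation. A small compact neighbourhood of the point contains besides it only isolated
  points of the layer, so the filter consists of the sets containing almost all of one
  set \<open>A\<close> (\<open>ex_almost_smallest_large\<close>). Invariance says that \<open>A\<close> differs from its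
  translates by finitely many elements, so membership in \<open>A\<close> is constant far out to the right and
  far out to the left. Up to a finite set, \<open>A\<close> is thus empty, the positive integers, the
  negative integers, or everything, and these four cases are the four topologies.
\<close>

section \<open>Topological and arithmetical preliminaries\<close>

text \<open>
  Otherwise the set would be a countable union of closed singletons with empty interior, against
  the Baire category theorem.
\<close>

lemma countable_open_has_isolated_point:
  assumes "Hausdorff_space X" "locally_compact_space X"
    and U: "openin X U" "U \<noteq> {}" "countable U"
  shows "\<exists>x\<in>U. openin X {x}"
proof (rule ccontr)
  assume no: "\<not> (\<exists>x\<in>U. openin X {x})"
  have "X interior_of \<Union> ((\<lambda>x. {x}) ` U) = {}"
  proof (rule Baire_category_alt)
    show "completely_metrizable_space X \<or> locally_compact_space X \<and> regular_space X"
      using assms locally_compact_Hausdorff_imp_regular_space by blast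
    show "countable ((\<lambda>x. {x}) ` U)" using U by simp
  next
    fix T assume "T \<in> (\<lambda>x. {x}) ` U"
    then obtain x where x: "x \<in> U" "T = {x}" by blast
    have "x \<in> topspace X" using x U openin_subset by blast
    then have "closedin X T" using assms(1) x by (simp add: closedin_Hausdorff_sing_eq)
    moreover have "X interior_of T = {}"
      using x no by (metis interior_of_subset openin_interior_of subset_singletonD)
    ultimately show "closedin X T \<and> X interior_of T = {}" by blast
  qed
  then show False using U by (simp add: interior_of_openin)
qed

text \<open>
  Beyond \<open>N\<close> membership in \<open>A\<close> does not change, so one of the two sets lies in the interval from \<open>0\<close>
  to \<open>N\<close>.
\<close>

lemma eventually_constant_half_line:
  fixes A :: "int set"
  assumes step: "\<And>t. t \<ge> N \<Longrightarrow> t \<in> A \<longleftrightarrow> t + 1 \<in> A"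
  shows "finite (A \<inter> {0<..}) \<or> finite ({0<..} - A)"
proof -
  have const: "t \<in> A \<longleftrightarrow> N \<in> A" if "t \<ge> N" for t
    using that
  proof (induction t rule: int_ge_induct)
    case (step t)
    then show ?case using assms by blast
  qed simp
  show ?thesis
  proof (cases "N \<in> A")
    case True
    then have "{0<..} - A \<subseteq> {0..N}"
      using const by (metis DiffE atLeastAtMost_iff greaterThan_iff less_imp_le linear subsetI)
    then show ?thesis using finite_subset by blast
  next
    case False
    then have "A \<inter> {0<..} \<subseteq> {0..N}"
      using const by (metis IntE atLeastAtMost_iff greaterThan_iff less_imp_le linear subsetI)
    then show ?thesis using finite_subset by blast
  qed
qed

text \<open>
  Invariance under the translations by \<open>1\<close> and \<open>-1\<close> makes the set of places where membership in \<open>A\<close>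
  changes finite.
\<close>

lemma almost_invariant_half_line:
  fixes A :: "int set"
  assumes "\<And>s. finite (A - {t. s + t \<in> A})"
  shows "finite (A \<inter> {0<..}) \<or> finite ({0<..} - A)"
proof -
  \<comment> \<open>\<open>t\<close> is in \<open>?D\<close> iff exactly one of \<open>t\<close> and \<open>t + 1\<close> is in \<open>A\<close>.\<close>
  let ?D = "(A - {t. 1 + t \<in> A}) \<union> (+) (-1) ` (A - {t. -1 + t \<in> A})"
  have "finite ?D" using assms by blast
  then obtain N where N: "\<And>t. t \<in> ?D \<Longrightarrow> t < N"
    by (meson finite_subset bdd_above_finite bdd_above_def le_less_trans lt_ex gt_ex)
  have "t \<in> A \<longleftrightarrow> t + 1 \<in> A" if "t \<ge> N" for t
  proof -
    have "t \<notin> ?D" using N that by (meson not_le)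
    then have "\<not> (t \<in> A \<and> 1 + t \<notin> A)" "\<not> (1 + t \<in> A \<and> t \<notin> A)"
      by force+
    then show ?thesis by (auto simp: add.commute)
  qed
  then show ?thesis by (rule eventually_constant_half_line)
qed

lemma uminus_image_Collect: "uminus ` A = {t. - t \<in> A}" for A :: "int set"
  by force

text \<open>
  The reflection \<open>t \<mapsto> -t\<close> turns this into the statement about the positive half-line.
\<close>

lemma almost_invariant_negative_half_line:
  fixes A :: "int set"
  assumes "\<And>s. finite (A - {t. s + t \<in> A})"
  shows "finite (A \<inter> {..<0}) \<or> finite ({..<0} - A)"
proof -
  have "finite (uminus ` A - {t. s + t \<in> uminus ` A})" for s
  proof -
    have "uminus ` A - {t. s + t \<in> uminus ` A} = uminus ` (A - {t. (-s) + t \<in> A})"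
      by (auto simp: uminus_image_Collect add.commute)
    then show ?thesis using finite_imageI[OF assms] by metis
  qed
  then have "finite (uminus ` A \<inter> {0<..}) \<or> finite ({0<..} - uminus ` A)"
    by (rule almost_invariant_half_line)
  moreover have "uminus ` A \<inter> {0<..} = uminus ` (A \<inter> {..<0})"
    "{0<..} - uminus ` A = uminus ` ({..<0} - A)"
    by (auto simp: uminus_image_Collect)
  ultimately show ?thesis by (simp add: finite_image_iff)
qed

text \<open>
  The filters generated by the three families, described by what a member may miss. In this
  form the families are compared with the filter of an unknown topology, and with each other.
\<close>

lemma ex_subset_cf_family: "(\<exists>C\<in>cf_family. C \<subseteq> B) \<longleftrightarrow> finite (- B)"
proof
  assume "finite (- B)"
  then have "UNIV - (- B) \<in> cf_family" unfolding cf_family_def by blast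
  then show "\<exists>C\<in>cf_family. C \<subseteq> B" by (rule rev_bexI) blast
next
  assume "\<exists>C\<in>cf_family. C \<subseteq> B"
  then obtain F where "finite F" "UNIV - F \<subseteq> B" unfolding cf_family_def by blast
  moreover from this(2) have "- B \<subseteq> F" by blast
  ultimately show "finite (- B)" using finite_subset by blast
qed

lemma ex_subset_plus_family: "(\<exists>C\<in>plus_family. C \<subseteq> B) \<longleftrightarrow> finite ({0<..} - B)"
proof
  assume "finite ({0<..} - B)"
  then have "{0<..} - ({0<..} - B) \<in> plus_family" unfolding plus_family_def by blast
  then show "\<exists>C\<in>plus_family. C \<subseteq> B" by (rule rev_bexI) blast
next
  assume "\<exists>C\<in>plus_family. C \<subseteq> B"
  then obtain F where "finite F" "{0<..} - F \<subseteq> B" unfolding plus_family_def by blast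
  moreover from this(2) have "{0<..} - B \<subseteq> F" by blast
  ultimately show "finite ({0<..} - B)" using finite_subset by blast
qed

lemma ex_subset_minus_family: "(\<exists>C\<in>minus_family. C \<subseteq> B) \<longleftrightarrow> finite ({..<0} - B)"
proof
  assume fin: "finite ({..<0} - B)"
  have "uminus ` ({..<0} - B) \<subseteq> {0<..}" by auto
  then have "uminus ` {0<..} - uminus ` uminus ` ({..<0} - B) \<in> minus_family"
    unfolding minus_family_def using fin by blast
  moreover have "uminus ` {0<..} - uminus ` uminus ` ({..<0} - B) \<subseteq> B"
    by (auto simp: image_image)
  ultimately show "\<exists>C\<in>minus_family. C \<subseteq> B" by blast
next
  assume "\<exists>C\<in>minus_family. C \<subseteq> B"
  then obtain F where F: "finite F" "uminus ` {0<..} - uminus ` F \<subseteq> B"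
    unfolding minus_family_def by blast
  have "{..<0} - B \<subseteq> uminus ` F" using F(2) by (auto simp: uminus_image_Collect)
  then show "finite ({..<0} - B)" using F(1) finite_subset by blast
qed


section \<open>Points with a neighbourhood inside one or two layers\<close>

abbreviation mult0 :: "reilly \<Rightarrow> reilly \<Rightarrow> reilly" (infixl "\<cdot>" 70) where
  "a \<cdot> b \<equiv> reilly_mult (\<lambda>z. 0) a b"

lemma mult0_eq:
  "(i, s, j) \<cdot> (m, t, n) =
     (if j = m then (i, s + t, n) else if j < m then (i + m - j, t, n) else (i, s, j + n - m))"
proof -
  have "((\<lambda>z::int. 0::int) ^^ k) x = (if k = 0 then x else 0)" for k x
    by (cases k) auto
  then show ?thesis by (auto simp: reilly_mult_def)
qed

locale reilly_topology =
  fixes \<tau> :: "reilly topology"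
  assumes top: "topspace \<tau> = UNIV"
    and haus: "Hausdorff_space \<tau>"
    and lc: "locally_compact_space \<tau>"
    and shift: "shift_continuous (reilly_mult (\<lambda>z. 0)) \<tau>"
begin

lemma left_shift: "continuous_map \<tau> \<tau> (\<lambda>x. a \<cdot> x)"
  and right_shift: "continuous_map \<tau> \<tau> (\<lambda>x. x \<cdot> a)"
  using shift top unfolding shift_continuous_def by blast+

lemma open_left_preimage: "openin \<tau> U \<Longrightarrow> openin \<tau> {x. a \<cdot> x \<in> U}"
  using openin_continuous_map_preimage[OF left_shift] top by fastforce

lemma open_right_preimage: "openin \<tau> U \<Longrightarrow> openin \<tau> {x. x \<cdot> a \<in> U}"
  using openin_continuous_map_preimage[OF right_shift] top by fastforce

lemma open_Compl_finite: "finite F \<Longrightarrow> openin \<tau> (- F)"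
  using closedin_Hausdorff_finite[OF haus, of F] top by (simp add: closedin_def Compl_eq_Diff_UNIV)

text \<open>
  The left shift by the idempotent \<open>(i + 1, 0, i + 1)\<close> fixes exactly the triples whose first entry
  is larger than \<open>i\<close>; in a Hausdorff space the fixed points of a continuous map form a closed set.
\<close>

lemma open_fst_le: "openin \<tau> {(m, t, n). m \<le> i}"
proof -
  have "closedin \<tau> {x \<in> topspace \<tau>. (i + 1, 0, i + 1) \<cdot> x = id x}"
    by (intro closedin_continuous_maps_eq[OF haus] left_shift) simp
  moreover have "{x \<in> topspace \<tau>. (i + 1, 0, i + 1) \<cdot> x = id x} = UNIV - {(m, t, n). m \<le> i}"
    using top by (auto simp: mult0_eq split: if_splits)
  ultimately show ?thesis using top by (simp add: closedin_def double_diff)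
qed

lemma open_snd_le: "openin \<tau> {(m, t, n). n \<le> j}"
proof -
  have "closedin \<tau> {x \<in> topspace \<tau>. x \<cdot> (j + 1, 0, j + 1) = id x}"
    by (intro closedin_continuous_maps_eq[OF haus] right_shift) simp
  moreover have "{x \<in> topspace \<tau>. x \<cdot> (j + 1, 0, j + 1) = id x} = UNIV - {(m, t, n). n \<le> j}"
    using top by (auto simp: mult0_eq split: if_splits)
  ultimately show ?thesis using top by (simp add: closedin_def double_diff)
qed

lemma open_rectangle: "openin \<tau> {(m, t, n). m \<le> i \<and> n \<le> j}"
proof -
  have "{(m::nat, t::int, n::nat). m \<le> i \<and> n \<le> j} = {(m, t, n). m \<le> i} \<inter> {(m, t, n). n \<le> j}" by auto
  then show ?thesis using open_fst_le open_snd_le by (metis openin_Int)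
qed

text \<open>
  Inside the rectangle, the left shift by \<open>(i, 0, i)\<close> collapses all triples with smaller first entry
  to one of finitely many triples with middle entry \<open>0\<close>, while it fixes the triples with
  first entry \<open>i\<close>. Requiring that these values be avoided removes the smaller first entries together with
  \<open>(i, 0, j)\<close>; the right shift by \<open>(j, 0, j)\<close> treats the last entries in the same way.
\<close>

lemma open_punctured_layer: "openin \<tau> (layer (- {0}) i j)"
proof -
  let ?R = "{(m, t, n). m \<le> i \<and> n \<le> j}"
  let ?F = "{i} \<times> {0} \<times> {..i + j} :: reilly set"
  let ?G = "{..i + j} \<times> {0} \<times> {j} :: reilly set"
  have "openin \<tau> (?R \<inter> {x. (i, 0, i) \<cdot> x \<in> - ?F} \<inter> {x. x \<cdot> (j, 0, j) \<in> - ?G})"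
    by (intro openin_Int open_rectangle open_left_preimage open_right_preimage open_Compl_finite) auto
  also have "?R \<inter> {x. (i, 0, i) \<cdot> x \<in> - ?F} \<inter> {x. x \<cdot> (j, 0, j) \<in> - ?G} = layer (- {0}) i j"
    by (auto simp: layer_def mult0_eq split: if_splits)
  finally show ?thesis .
qed

text \<open>
  On the boundary only one of the outer entries has to be pinned down. The shift that does this sends
  the unwanted triples to points different from \<open>(i, 0, j)\<close>, so here \<open>0\<close> need not be removed.
\<close>

lemma open_boundary_layer:
  assumes "i = 0 \<or> j = 0"
  shows "openin \<tau> (layer UNIV i j)"
  using assms
proof
  assume [simp]: "i = 0"
  let ?G = "{1..j} \<times> {0} \<times> {j} :: reilly set"
  have "openin \<tau> ({(m, t, n). m \<le> i \<and> n \<le> j} \<inter> {x. x \<cdot> (j, 0, j) \<in> - ?G})"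
    by (intro openin_Int open_rectangle open_right_preimage open_Compl_finite) auto
  also have "{(m, t, n). m \<le> i \<and> n \<le> j} \<inter> {x. x \<cdot> (j, 0, j) \<in> - ?G} = layer UNIV i j"
    by (auto simp: layer_def mult0_eq split: if_splits)
  finally show ?thesis .
next
  assume [simp]: "j = 0"
  let ?F = "{i} \<times> {0} \<times> {1..i} :: reilly set"
  have "openin \<tau> ({(m, t, n). m \<le> i \<and> n \<le> j} \<inter> {x. (i, 0, i) \<cdot> x \<in> - ?F})"
    by (intro openin_Int open_rectangle open_left_preimage open_Compl_finite) auto
  also have "{(m, t, n). m \<le> i \<and> n \<le> j} \<inter> {x. (i, 0, i) \<cdot> x \<in> - ?F} = layer UNIV i j"
    by (auto simp: layer_def mult0_eq split: if_splits)
  finally show ?thesis .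
qed

text \<open>
  Multiplying by \<open>(i + 1, 0, i + 1)\<close> on the left and by \<open>(j + 1, 0, j + 1)\<close> on the right sends the triples of
  the rectangle outside the layer at \<open>(i + 1, j + 1)\<close> to finitely many points. Exactly those on the diagonal
  below \<open>(i + 1, j + 1)\<close> go to \<open>(i + 1, 0, j + 1)\<close>, so all others can be removed. On that diagonal, the
  left shift by \<open>(i, 0, i)\<close> collapses everything below the layer at \<open>(i, j)\<close> to \<open>(i, 0, j)\<close> and fixes
  the layer at \<open>(i, j)\<close>; avoiding \<open>(i, 0, j)\<close> leaves the asserted set.
\<close>

lemma open_two_layers: "openin \<tau> (layer (- {0}) i j \<union> layer UNIV (i + 1) (j + 1))"
proof -
  let ?e = "(i + 1, 0, i + 1) :: reilly" and ?f = "(j + 1, 0, j + 1) :: reilly"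
  let ?R = "{(m, t, n). m \<le> i + 1 \<and> n \<le> j + 1} :: reilly set"
  let ?F = "{..i + j + 2} \<times> {0} \<times> {..i + j + 2} - {(i + 1, 0, j + 1)} :: reilly set"
  let ?U = "{x. ?e \<cdot> x \<in> {y. y \<cdot> ?f \<in> - ?F}}" and ?V = "{x. (i, 0, i) \<cdot> x \<in> - {(i, 0, j)}}"
  have "openin \<tau> (?R \<inter> ?U \<inter> ?V)"
    by (intro openin_Int open_rectangle open_left_preimage open_right_preimage open_Compl_finite) auto
  also have "?R \<inter> ?U \<inter> ?V = layer (- {0}) i j \<union> layer UNIV (i + 1) (j + 1)"
  proof (intro equalityI subsetI)
    fix x assume x: "x \<in> ?R \<inter> ?U \<inter> ?V"
    obtain m t n where [simp]: "x = (m, t, n)" by (cases x)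
    have le: "m \<le> i + 1" "n \<le> j + 1" using x by auto
    show "x \<in> layer (- {0}) i j \<union> layer UNIV (i + 1) (j + 1)"
    proof (cases "m = i + 1")
      case True
      then show ?thesis using x le by (auto simp: layer_def mult0_eq split: if_splits)
    next
      case False
      then have "m \<le> i" using le by simp
      \<comment> \<open>Off the diagonal the two-sided product would be a value in \<open>?F\<close>.\<close>
      then have "m + j = n + i"
        using x le by (auto simp: mult0_eq split: if_splits)
      then show ?thesis using x le \<open>m \<le> i\<close> by (auto simp: layer_def mult0_eq split: if_splits)
    qed
  next
    fix x assume "x \<in> layer (- {0}) i j \<union> layer UNIV (i + 1) (j + 1)"
    then show "x \<in> ?R \<inter> ?U \<inter> ?V"
      by (auto simp: layer_def mult0_eq split: if_splits)
  qed
  finally show ?thesis .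
qed

text \<open>
  The punctured layer is countable and open, so it has an isolated point \<open>(i, t, j)\<close>. The left shift by
  \<open>(i, t - s, i)\<close> translates the layer and takes \<open>(i, s, j)\<close> to it. The statement is only relative
  to the layer because the shift may send points outside the layer to the isolated point as well.
\<close>

lemma relatively_open_singleton:
  "\<exists>U. openin \<tau> U \<and> U \<inter> layer UNIV i j = {(i, s, j)}"
proof -
  have "(i, 1, j) \<in> layer (- {0}) i j" by (simp add: layer_def)
  moreover have "countable (layer (- {0}) i j)" by simp
  ultimately obtain x where x: "x \<in> layer (- {0}) i j" "openin \<tau> {x}"
    using countable_open_has_isolated_point[OF haus lc open_punctured_layer] by blast
  then obtain t where t: "x = (i, t, j)" by (auto simp: layer_def)
  let ?U = "{y. (i, t - s, i) \<cdot> y \<in> {x}}"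
  have "openin \<tau> ?U" using x(2) by (rule open_left_preimage)
  moreover have "?U \<inter> layer UNIV i j = {(i, s, j)}" by (auto simp: t layer_def mult0_eq)
  ultimately show ?thesis by blast
qed

lemma isolated_in_open_layer:
  assumes "openin \<tau> (layer A i j)" "s \<in> A"
  shows "openin \<tau> {(i, s, j)}"
proof -
  obtain U where U: "openin \<tau> U" "U \<inter> layer UNIV i j = {(i, s, j)}"
    using relatively_open_singleton by blast
  have "layer A i j \<subseteq> layer UNIV i j" "(i, s, j) \<in> layer A i j"
    using assms(2) by (auto simp: layer_def)
  then have "U \<inter> layer A i j = {(i, s, j)}" using U(2) by blast
  then show ?thesis using U(1) assms(1) by (metis openin_Int)
qed

lemma isolated_nonzero: "s \<noteq> 0 \<Longrightarrow> openin \<tau> {(i, s, j)}"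
  by (rule isolated_in_open_layer[OF open_punctured_layer]) simp

lemma isolated_boundary: "i = 0 \<or> j = 0 \<Longrightarrow> openin \<tau> {(i, s, j)}"
  by (rule isolated_in_open_layer[OF open_boundary_layer]) simp_all

text \<open>
  This is where the layer of \<open>(i + 1, 0, j + 1)\<close> is discarded from its neighbourhoods, leaving only the
  layer one step down the diagonal as a place from which the point can be approached.
\<close>

lemma open_layer0: "openin \<tau> (layer0 (- {0}) i j)"
proof -
  obtain U where U: "openin \<tau> U" "U \<inter> layer UNIV (i + 1) (j + 1) = {(i + 1, 0, j + 1)}"
    using relatively_open_singleton by blast
  let ?W = "layer (- {0}) i j \<union> layer UNIV (i + 1) (j + 1)"
  have "openin \<tau> (layer (- {0}) i j \<union> U \<inter> ?W)"
    by (intro openin_Un openin_Int open_punctured_layer open_two_layers U(1))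
  moreover have "layer (- {0}) i j \<union> U \<inter> ?W = layer0 (- {0}) i j"
    using U(2) unfolding layer0_def by blast
  ultimately show ?thesis by simp
qed


section \<open>The trace of the neighbourhood filters on the integers\<close>

text \<open>
  The filter of integer sets \<open>A\<close> whose copy in the layer at \<open>(i, j)\<close> contains all points of that layer
  in some neighbourhood of \<open>(i + 1, 0, j + 1)\<close>. It is improper exactly if this point is isolated.
\<close>

definition large :: "nat \<Rightarrow> nat \<Rightarrow> int set \<Rightarrow> bool" where
  "large i j A \<longleftrightarrow> (\<exists>U. openin \<tau> U \<and> (i + 1, 0, j + 1) \<in> U \<and> {t. (i, t, j) \<in> U} \<subseteq> A)"

text \<open>
  All other points are isolated, and \<open>layer0 (- {0}) i j\<close> is a neighbourhood of \<open>(i + 1, 0, j + 1)\<close>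
  that consists of this point and of a part of the layer at \<open>(i, j)\<close>.
\<close>

lemma openin_iff_large:
  "openin \<tau> U \<longleftrightarrow> (\<forall>i j. (i + 1, 0, j + 1) \<in> U \<longrightarrow> large i j {t. (i, t, j) \<in> U})"
proof
  assume "openin \<tau> U"
  then show "\<forall>i j. (i + 1, 0, j + 1) \<in> U \<longrightarrow> large i j {t. (i, t, j) \<in> U}"
    unfolding large_def by blast
next
  assume L: "\<forall>i j. (i + 1, 0, j + 1) \<in> U \<longrightarrow> large i j {t. (i, t, j) \<in> U}"
  show "openin \<tau> U"
  proof (subst openin_subopen, intro ballI)
    fix x assume x: "x \<in> U"
    obtain m t n where m: "x = (m, t, n)" by (cases x)
    show "\<exists>T. openin \<tau> T \<and> x \<in> T \<and> T \<subseteq> U"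
    proof (cases "t \<noteq> 0 \<or> m = 0 \<or> n = 0")
      case True
      then have "openin \<tau> {x}" unfolding m by (metis isolated_nonzero isolated_boundary)
      then show ?thesis using x by blast
    next
      case False
      then obtain i j where x': "x = (i + 1, 0, j + 1)"
        using m by (metis Suc_eq_plus1 not0_implies_Suc)
      then obtain V where V: "openin \<tau> V" "x \<in> V" "{t. (i, t, j) \<in> V} \<subseteq> {t. (i, t, j) \<in> U}"
        using L x unfolding large_def by blast
      have "openin \<tau> (V \<inter> layer0 (- {0}) i j)" using V(1) open_layer0 by blast
      moreover have "x \<in> V \<inter> layer0 (- {0}) i j" using V(2) x' by (simp add: layer0_def)
      moreover have "V \<inter> layer0 (- {0}) i j \<subseteq> U"
        using V(3) x x' by (auto simp: layer0_def layer_def)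
      ultimately show ?thesis by blast
    qed
  qed
qed

lemma large_mono: "large i j A \<Longrightarrow> A \<subseteq> B \<Longrightarrow> large i j B"
  unfolding large_def by blast

lemma large_Diff_finite:
  assumes "large i j A" "finite F"
  shows "large i j (A - F)"
proof -
  obtain U where U: "openin \<tau> U" "(i + 1, 0, j + 1) \<in> U" "{t. (i, t, j) \<in> U} \<subseteq> A"
    using assms(1) unfolding large_def by blast
  let ?V = "U \<inter> - ((\<lambda>t. (i, t, j)) ` F)"
  have "openin \<tau> ?V" using U(1) assms(2) by (intro openin_Int open_Compl_finite) auto
  moreover have "(i + 1, 0, j + 1) \<in> ?V" "{t. (i, t, j) \<in> ?V} \<subseteq> A - F" using U by auto
  ultimately show ?thesis unfolding large_def by blast
qed

text \<open>
  The left shift by \<open>(i, s, i)\<close> fixes \<open>(i + 1, 0, j + 1)\<close> and translates the layer at \<open>(i, j)\<close>.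
\<close>

lemma large_translate:
  assumes "large i j A"
  shows "large i j {t. s + t \<in> A}"
proof -
  obtain U where U: "openin \<tau> U" "(i + 1, 0, j + 1) \<in> U" "{t. (i, t, j) \<in> U} \<subseteq> A"
    using assms unfolding large_def by blast
  let ?V = "{x. (i, s, i) \<cdot> x \<in> U}"
  have "openin \<tau> ?V" using U(1) by (rule open_left_preimage)
  moreover have "(i + 1, 0, j + 1) \<in> ?V" "{t. (i, t, j) \<in> ?V} \<subseteq> {t. s + t \<in> A}"
    using U by (auto simp: mult0_eq)
  ultimately show ?thesis unfolding large_def by blast
qed

text \<open>
  Multiplying by \<open>(i, 0, k)\<close> on the left and by \<open>(l, 0, j)\<close> on the right takes \<open>(k + 1, 0, l + 1)\<close> to
  \<open>(i + 1, 0, j + 1)\<close> and the layer at \<open>(k, l)\<close> to the one at \<open>(i, j)\<close>, with the same middle entries.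
\<close>

lemma large_transfer:
  assumes "large i j A"
  shows "large k l A"
proof -
  obtain U where U: "openin \<tau> U" "(i + 1, 0, j + 1) \<in> U" "{t. (i, t, j) \<in> U} \<subseteq> A"
    using assms unfolding large_def by blast
  let ?V = "{x. (i, 0, k) \<cdot> x \<in> {y. y \<cdot> (l, 0, j) \<in> U}}"
  have "openin \<tau> ?V" using U(1) by (intro open_left_preimage open_right_preimage)
  moreover have "(k + 1, 0, l + 1) \<in> ?V" "{t. (k, t, l) \<in> ?V} \<subseteq> A"
    using U by (auto simp: mult0_eq)
  ultimately show ?thesis unfolding large_def by blast
qed

text \<open>
  Let \<open>A\<close> be cut out by a compact neighbourhood of \<open>(1, 0, 1)\<close> inside \<open>layer0 (- {0}) 0 0\<close>. Any open
  neighbourhood of the point together with the isolated points of the layer covers this compact set,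
  so it leaves out only finitely many elements of \<open>A\<close>.
\<close>

lemma ex_almost_smallest_large:
  "\<exists>A. \<forall>i j B. large i j B \<longleftrightarrow> finite (A - B)"
proof -
  have "neighbourhood_base_of (compactin \<tau>) \<tau>"
    using haus lc locally_compact_space_neighbourhood_base by blast
  moreover have "(1, 0, 1) \<in> layer0 (- {0}) 0 0" by (simp add: layer0_def)
  ultimately obtain V K where V: "openin \<tau> V" "compactin \<tau> K" "(1, 0, 1) \<in> V" "V \<subseteq> K"
    "K \<subseteq> layer0 (- {0}) 0 0"
    using open_layer0[of 0 0] unfolding neighbourhood_base_of by metis
  define A where "A = {t. (0, t, 0) \<in> K}"
  have A: "large 0 0 A" unfolding large_def A_def using V by auto
  have "finite (A - B)" if B: "large 0 0 B" for B
  proof -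
    obtain U where U: "openin \<tau> U" "(1, 0, 1) \<in> U" "{t. (0, t, 0) \<in> U} \<subseteq> B"
      using B unfolding large_def by auto
    let ?\<U> = "insert U ((\<lambda>t. {(0, t, 0)}) ` (- {0}))"
    have "\<exists>\<F>. finite \<F> \<and> \<F> \<subseteq> ?\<U> \<and> K \<subseteq> \<Union>\<F>"
    proof (rule compactinD[OF V(2)])
      show "openin \<tau> T" if "T \<in> ?\<U>" for T using that U(1) isolated_nonzero by auto
      show "K \<subseteq> \<Union>?\<U>" using V(5) U(2) by (auto simp: layer0_def layer_def)
    qed
    then obtain \<F> where F: "finite \<F>" "\<F> \<subseteq> ?\<U>" "K \<subseteq> \<Union>\<F>" by blast
    \<comment> \<open>A point outside \<open>U\<close> can only be covered by its own singleton.\<close>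
    have "(\<lambda>t. {(0, t, 0)}) ` (A - B) \<subseteq> \<F>"
    proof
      fix T assume "T \<in> (\<lambda>t. {(0::nat, t, 0::nat)}) ` (A - B)"
      then obtain t where t: "T = {(0, t, 0)}" "t \<in> A" "t \<notin> B" by blast
      then obtain T' where T': "T' \<in> \<F>" "(0, t, 0) \<in> T'" using F(3) A_def by blast
      have "(0, t, 0) \<notin> U" using U(3) t(3) by blast
      then have "T' = T" using T' F(2) t(1) by blast
      then show "T \<in> \<F>" using T' by blast
    qed
    then have "finite ((\<lambda>t. {(0::nat, t, 0::nat)}) ` (A - B))" using F(1) finite_subset by blast
    then show ?thesis by (rule finite_imageD) (auto simp: inj_on_def)
  qed
  moreover have "large 0 0 B" if "finite (A - B)" for B
    using large_mono[OF large_Diff_finite[OF A that]] by blast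
  ultimately have "large 0 0 B \<longleftrightarrow> finite (A - B)" for B by blast
  then show ?thesis using large_transfer by meson
qed

text \<open>
  Both topologies are determined by their behaviour at the points \<open>(i + 1, 0, j + 1)\<close>, where the
  family has to generate the filter \<open>large\<close>.
\<close>

lemma topology_eqI:
  assumes fam: "filtered_family \<A>"
    and L: "\<And>i j B. large i j B \<longleftrightarrow> (\<exists>C\<in>\<A>. C \<subseteq> B)"
  shows "\<tau> = nbhd_topology (reilly_base \<A>)"
proof (rule topology_eq[THEN iffD2], intro allI)
  fix U
  have "(\<forall>x\<in>U. \<exists>V\<in>reilly_base \<A> x. V \<subseteq> U) \<longleftrightarrow>
        (\<forall>i j. (i + 1, 0, j + 1) \<in> U \<longrightarrow> (\<exists>C\<in>\<A>. layer0 C i j \<subseteq> U))" (is "?l \<longleftrightarrow> ?r")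
  proof
    assume l: ?l
    show ?r
    proof (intro allI impI)
      fix i j assume "(i + 1, 0::int, j + 1) \<in> U"
      then have "\<exists>V\<in>reilly_base \<A> (i + 1, 0, j + 1). V \<subseteq> U" using l by blast
      then show "\<exists>C\<in>\<A>. layer0 C i j \<subseteq> U" by (auto simp: reilly_base_def)
    qed
  next
    assume r: ?r
    show ?l
    proof
      fix x assume x: "x \<in> U"
      obtain m t n where m: "x = (m, t, n)" by (cases x)
      show "\<exists>V\<in>reilly_base \<A> x. V \<subseteq> U"
      proof (cases "t \<noteq> 0 \<or> m = 0 \<or> n = 0")
        case True
        then show ?thesis using x by (auto simp: m reilly_base_def)
      next
        case False
        then obtain i j where x': "x = (i + 1, 0, j + 1)"
          using m by (metis Suc_eq_plus1 not0_implies_Suc)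
        then obtain C where "C \<in> \<A>" "layer0 C i j \<subseteq> U" using r x by blast
        then show ?thesis by (auto simp: x' reilly_base_def)
      qed
    qed
  qed
  also have "\<dots> \<longleftrightarrow> (\<forall>i j. (i + 1, 0, j + 1) \<in> U \<longrightarrow> large i j {t. (i, t, j) \<in> U})"
    unfolding L by (auto simp: layer0_def layer_def subset_iff)
  finally show "openin \<tau> U \<longleftrightarrow> openin (nbhd_topology (reilly_base \<A>)) U"
    unfolding openin_reilly_base[OF fam] openin_iff_large by simp
qed

lemma one_of_four_topologies:
  "\<tau> = discrete_topology UNIV \<or> \<tau> = tau_cf \<or> \<tau> = tau_plus \<or> \<tau> = tau_minus"
proof -
  obtain A where A: "\<And>i j B. large i j B \<longleftrightarrow> finite (A - B)"
    using ex_almost_smallest_large by blast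
  have inv: "finite (A - {t. s + t \<in> A})" for s
    using large_translate[of 0 0 A s] by (simp add: A)
  have A0: "A \<subseteq> A \<inter> {0<..} \<union> A \<inter> {..<0} \<union> {0}" by force
  consider (none) "finite (A \<inter> {0<..})" "finite (A \<inter> {..<0})"
    | (plus) "finite ({0<..} - A)" "finite (A \<inter> {..<0})"
    | (minus) "finite (A \<inter> {0<..})" "finite ({..<0} - A)"
    | (both) "finite ({0<..} - A)" "finite ({..<0} - A)"
    using almost_invariant_half_line[OF inv] almost_invariant_negative_half_line[OF inv] by blast
  then show ?thesis
  proof cases
    case none
    then have "finite A" using A0 finite_subset by blast
    then have "large i j B" for i j B by (simp add: A)
    then have "openin \<tau> U" for U by (simp add: openin_iff_large)
    then have "\<tau> = discrete_topology UNIV" by (simp add: topology_eq)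
    then show ?thesis by blast
  next
    case plus
    have "large i j B \<longleftrightarrow> (\<exists>C\<in>plus_family. C \<subseteq> B)" for i j B
    proof -
      have "A - B \<subseteq> ({0<..} - B) \<union> (A \<inter> {..<0}) \<union> {0}" "{0<..} - B \<subseteq> (A - B) \<union> ({0<..} - A)"
        using A0 by auto
      then show ?thesis
        unfolding A ex_subset_plus_family using plus
        by (meson finite.emptyI finite.insertI finite_UnI finite_subset)
    qed
    then show ?thesis using topology_eqI[OF filtered_plus_family] tau_plus_def by simp
  next
    case minus
    have "large i j B \<longleftrightarrow> (\<exists>C\<in>minus_family. C \<subseteq> B)" for i j B
    proof -
      have "A - B \<subseteq> ({..<0} - B) \<union> (A \<inter> {0<..}) \<union> {0}" "{..<0} - B \<subseteq> (A - B) \<union> ({..<0} - A)"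
        using A0 by auto
      then show ?thesis
        unfolding A ex_subset_minus_family using minus
        by (meson finite.emptyI finite.insertI finite_UnI finite_subset)
    qed
    then show ?thesis using topology_eqI[OF filtered_minus_family] tau_minus_def by simp
  next
    case both
    have "large i j B \<longleftrightarrow> (\<exists>C\<in>cf_family. C \<subseteq> B)" for i j B
    proof -
      have "- B \<subseteq> (A - B) \<union> ({0<..} - A) \<union> ({..<0} - A) \<union> {0}" "A - B \<subseteq> - B" by force+
      then show ?thesis
        unfolding A ex_subset_cf_family using both
        by (meson finite.emptyI finite.insertI finite_UnI finite_subset)
    qed
    then show ?thesis using topology_eqI[OF filtered_cf_family] tau_cf_def by simp
  qed
qed

end


section \<open>The four topologies are distinct\<close>

text \<open>
  Of the points of \<open>layer0 B 0 0\<close> only \<open>(1, 0, 1)\<close> can fail to be isolated, so these sets read off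
  the filter generated by the family. They serve to tell the topologies apart.
\<close>

lemma openin_reilly_base_layer0:
  assumes "filtered_family \<A>"
  shows "openin (nbhd_topology (reilly_base \<A>)) (layer0 B 0 0) \<longleftrightarrow> (\<exists>C\<in>\<A>. C \<subseteq> B)"
  unfolding openin_reilly_base[OF assms]
proof
  assume "\<forall>x\<in>layer0 B 0 0. \<exists>V\<in>reilly_base \<A> x. V \<subseteq> layer0 B 0 0"
  moreover have "(1, 0, 1) \<in> layer0 B 0 0" by (simp add: layer0_def)
  ultimately have "\<exists>V\<in>reilly_base \<A> (1, 0, 1). V \<subseteq> layer0 B 0 0" by blast
  then obtain C where "C \<in> \<A>" "layer0 C 0 0 \<subseteq> layer0 B 0 0" by (auto simp: reilly_base_def)
  moreover from this(2) have "C \<subseteq> B" by (auto simp: layer0_def layer_def)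
  ultimately show "\<exists>C\<in>\<A>. C \<subseteq> B" by blast
next
  assume "\<exists>C\<in>\<A>. C \<subseteq> B"
  then obtain C where C: "C \<in> \<A>" "C \<subseteq> B" by blast
  show "\<forall>x\<in>layer0 B 0 0. \<exists>V\<in>reilly_base \<A> x. V \<subseteq> layer0 B 0 0"
  proof
    fix x assume x: "x \<in> layer0 B 0 0"
    then consider "x = (1, 0, 1)" | s where "x = (0, s, 0)" by (auto simp: layer0_def layer_def)
    then show "\<exists>V\<in>reilly_base \<A> x. V \<subseteq> layer0 B 0 0"
    proof cases
      case 1
      then have "layer0 C 0 0 \<in> reilly_base \<A> x" using C(1) by (auto simp: reilly_base_def)
      then show ?thesis using layer0_mono[OF C(2)] by blast
    next
      case 2
      then show ?thesis using x by (simp add: reilly_base_def)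
    qed
  qed
qed

lemma openin_tau_layer0:
  "openin tau_cf (layer0 B 0 0) \<longleftrightarrow> finite (- B)"
  "openin tau_plus (layer0 B 0 0) \<longleftrightarrow> finite ({0<..} - B)"
  "openin tau_minus (layer0 B 0 0) \<longleftrightarrow> finite ({..<0} - B)"
  unfolding tau_cf_def tau_plus_def tau_minus_def
  by (simp_all only: openin_reilly_base_layer0 filtered_cf_family filtered_plus_family
      filtered_minus_family ex_subset_cf_family ex_subset_plus_family ex_subset_minus_family)

lemma topologies_distinct:
  "distinct [discrete_topology UNIV, tau_cf, tau_plus, tau_minus]"
proof -
  have "- {0<..} = {..0::int}" "- {..<0} = {0::int..}" "{..<0} - {0<..} = {..<0::int}" by auto
  then have "openin tau_plus (layer0 {0<..} 0 0)" "\<not> openin tau_cf (layer0 {0<..} 0 0)"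
    "\<not> openin tau_minus (layer0 {0<..} 0 0)"
    "openin tau_minus (layer0 {..<0} 0 0)" "\<not> openin tau_cf (layer0 {..<0} 0 0)"
    by (simp_all add: openin_tau_layer0 infinite_Iic infinite_Ici infinite_Iio)
  moreover have "\<not> openin tau_cf (layer0 {} 0 0)" "\<not> openin tau_plus (layer0 {} 0 0)"
    "\<not> openin tau_minus (layer0 {} 0 0)" "openin (discrete_topology UNIV) (layer0 {} 0 0)"
    by (simp_all add: openin_tau_layer0 infinite_Ioi infinite_Iio infinite_UNIV_int)
  ultimately show ?thesis by (auto simp del: openin_discrete_topology)
qed


section \<open>The classification\<close>

theorem theorem4p9:
  fixes \<theta> :: "int \<Rightarrow> int" and \<tau> :: "(nat \<times> int \<times> nat) topology"
  assumes "\<theta> = (\<lambda>z. 0)"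
    and "topspace \<tau> = UNIV"
    and "Hausdorff_space \<tau>"
    and "locally_compact_space \<tau>"
    and "shift_continuous (reilly_mult \<theta>) \<tau>"
  shows "\<exists>!k::nat. k < 4 \<and>
           [\<tau> = discrete_topology UNIV, \<tau> = tau_cf, \<tau> = tau_plus, \<tau> = tau_minus] ! k"
proof -
  interpret reilly_topology \<tau> using assms by unfold_locales auto
  let ?ts = "[discrete_topology UNIV, tau_cf, tau_plus, tau_minus]"
  have nth: "[\<tau> = discrete_topology UNIV, \<tau> = tau_cf, \<tau> = tau_plus, \<tau> = tau_minus] ! k
      \<longleftrightarrow> \<tau> = ?ts ! k" if "k < 4" for k
    using nth_map[of k ?ts "\<lambda>t. \<tau> = t"] that by simp
  have "\<tau> \<in> set ?ts" using one_of_four_topologies by auto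
  then obtain k where "k < length ?ts" "?ts ! k = \<tau>" by (meson in_set_conv_nth)
  then have "k < 4" "\<tau> = ?ts ! k" by simp_all
  moreover have "l = k" if "l < 4" "\<tau> = ?ts ! l" for l
    using nth_eq_iff_index_eq[OF topologies_distinct, of l k] that calculation by simp
  ultimately show ?thesis using nth by metis
qed

end
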